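(* Under the setting and assumptions of the context, for sufficiently small $\varepsilon>0$, the total cost of interpolation $\mathcal C_{\mathrm{int}}(\varepsilon)$ incurred in computing the accelerated initial vectors by sparse grid interpolation is bounded by $$ \mathcal C_{\mathrm{int}}(\varepsilon)\le M_h\,C_8\left(\frac{1}{rN}\log\left(\frac{3C_{\mathrm{sc}}}{\varepsilon}\right)\right)^{2N}\left\{C_2+\frac{1}{\log 2}\log\log\left(\frac{3C_{\mathrm{sc}}}{\varepsilon}\right)\right\}^{2(N-1)}, $$ where $C_2=1+\frac{1}{\log 2}\log\left(\frac{1}{rN}\right)$ and $C_8=64\,e^{2(N-1)}$.
   Context: **PDE and finite elements.** $D\subset\mathbb R^d$ ($d=1,2,3$) is a bounded domain, $\Gamma=[-1,1]^N$ carries a probability density $\varrho$. For $\bm y\in\Gamma$, $u(\bm y)\in H_0^1(D)$ solves $-\nabla\cdot(a(x,\bm y)\nabla u)=f(x,\bm y)$ in $D$, $u=0$ on $\partial D$, in weak form, with $0<a_{\min}\le a\le a_{\max}<\infty$ and $f$ square integrable. $u_h(\bm y)$ is its Galerkin approximation in a finite element space of dimension $M_h=\mathcal O(1/h^d)$ on a uniform mesh of size $h$. Assume $u\in L^2_\varrho(\Gamma;H_0^1(D)\cap H^{s+1}(D))$, $s\in\mathbb N_+$, and let $C_{\mathrm{fem}}$ be the constant with $\|u-u_h\|_{L^2_\varrho(\Gamma;H_0^1(D))}\le C_{\mathrm{fem}}h^s$. The mesh size is $h=h(\varepsilon)=(\varepsilon/(3C_{\mathrm{fem}}))^{1/s}$.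 **Sparse grid interpolation.** Let $m(1)=1$, $m(l)=2^{l-1}+1$ for $l>1$; $\vartheta^1=\{0\}$, $\vartheta^l=\{-\cos(\pi(j-1)/(m(l)-1)):1\le j\le m(l)\}$ for $l>1$ (nested Clenshaw–Curtis points). $\mathscr U^{m(l)}$ is one-dimensional Lagrange interpolation at $\vartheta^l$ by polynomials of degree $m(l)-1$, and $\mathscr U^{m(0)}=0$. The isotropic sparse grid operator is $\mathcal I_L=\sum_{\mathbf l\in\mathbb N_+^N,\ \sum_n(l_n-1)\le L}\bigotimes_{n=1}^N(\mathscr U^{m(l_n)}-\mathscr U^{m(l_n-1)})$, $L\in\mathbb N_+$. It uses the nested points $\mathcal H_L=\bigcup_{\sum_n(l_n-1)=L}\vartheta^{l_1}\times\cdots\times\vartheta^{l_N}=\{\bm y_{L,j}\}_{j=1}^{M_L}$, $M_L=\#\mathcal H_L$, and can be written $\mathcal I_L[v]=\sum_{j=1}^{M_L}v(\bm y_{L,j})\Psi_{L,j}$ with $\Psi_{L,j'}(\bm y_{L,j})=\delta_{jj'}$. Put $\Delta\mathcal H_1=\mathcal H_1$, $\Delta\mathcal H_L=\mathcal H_L\setminus\mathcal H_{L-1}$ for $L\ge2$, $\Delta M_L=\#\Delta\mathcal H_L$, and $M_0=1$. **Regularity.** $u:\Gamma\to H_0^1(D)$ has a complex extension analytic on $\prod_n\Sigma(n;\gamma_n)\subset\mathbb C^N$, $\gamma_n>1$, where $\Sigma(n;\gamma_n)=\{\tfrac12(z+z^{-1}):1\le|z|\le\gamma_n\}$ is the region bounded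 by the Bernstein ellipse; $u_h$ has the same property. For a fixed $0<\delta<1$ let $r=(1-\delta)\min_n\log\gamma_n$, and let $C_{\mathrm{sc}}>0$ (depending on $N,u,\delta$) be the constant such that $\|w-\mathcal I_L[w]\|_{L^\infty(\Gamma;H_0^1(D))}\le C_{\mathrm{sc}}e^{-rN2^{L/N}}$ for $w=u$ and $w=u_h$, $L\in\mathbb N_+$. **Interpolation cost.** In the accelerated algorithm, levels $L=1,\dots,L_{\max}(\varepsilon)$ are processed in order; for each new point $\bm y_{L,j}\in\Delta\mathcal H_L$ the initial vector $\bm c^{(0)}_{L,j}=\sum_{j'=1}^{M_{L-1}}\widetilde{\bm c}_{L-1,j'}\Psi_{L-1,j'}(\bm y_{L,j})\in\mathbb R^{M_h}$ is computed from the previously computed level-$(L-1)$ coefficient vectors. Each evaluation costs $2M_{L-1}-1$ operations per component, so the cost on level $L$ is $M_h\,\Delta M_L\,(2M_{L-1}-1)$, and $\mathcal C_{\mathrm{int}}(\varepsilon)=\sum_{L=1}^{L_{\max}(\varepsilon)}M_h\,\Delta M_L\,(2M_{L-1}-1)$. Here $L_{\max}(\varepsilon)=\frac{N}{\log2}\log\left(\frac1{rN}\log\frac{3C_{\mathrm{sc}}}{\varepsilon}\right)$, the minimum level with $C_{\mathrm{sc}}e^{-rN2^{L_{\max}/N}}\le\varepsilon/3$. **Convention.** The integer quantity $L_{\max}(\varepsilon)$ (really the ceiling of the displayed value) is treated as a positive real number, i.e. integer rounding is ignored. *)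

theory Defs
  imports "HOL-Probability.Probability" "HOL-Library.Landau_Symbols"
begin

section \<open>Sobolev spaces on a domain\<close>

text \<open>
  Elements of function spaces are represented by functions on the whole of \<open>real ^ 'd\<close>; only the
  values on \<open>D\<close>, up to null sets, matter.  The codomain is a Euclidean space so that real
  functions and their complexifications (needed for the analytic extension) are covered together.
\<close>

definition pderiv_dir :: "'d::finite \<Rightarrow> (real ^ 'd \<Rightarrow> 'b::euclidean_space) \<Rightarrow> real ^ 'd \<Rightarrow> 'b" where
  "pderiv_dir i \<phi> x = vector_derivative (\<lambda>t. \<phi> (x + t *\<^sub>R axis i 1)) (at 0)"

fun C_k :: "nat \<Rightarrow> (real ^ 'd::finite \<Rightarrow> 'b::euclidean_space) \<Rightarrow> bool" where
  "C_k 0 \<phi> \<longleftrightarrow> continuous_on UNIV \<phi>"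
| "C_k (Suc k) \<phi> \<longleftrightarrow> continuous_on UNIV \<phi> \<and>
     (\<forall>i. (\<forall>x. (\<lambda>t. \<phi> (x + t *\<^sub>R axis i 1)) differentiable (at 0)) \<and> C_k k (pderiv_dir i \<phi>))"

definition test_functions :: "(real ^ 'd::finite) set \<Rightarrow> (real ^ 'd \<Rightarrow> 'b::euclidean_space) set" where
  "test_functions D = {\<phi>. (\<forall>k. C_k k \<phi>) \<and> (\<exists>K. compact K \<and> K \<subseteq> D \<and> (\<forall>x. x \<notin> K \<longrightarrow> \<phi> x = 0))}"

definition L2 :: "(real ^ 'd::finite) set \<Rightarrow> (real ^ 'd \<Rightarrow> 'b::euclidean_space) set" where
  "L2 D = {v. v \<in> borel_measurable (lebesgue_on D) \<and> integrable (lebesgue_on D) (\<lambda>x. (norm (v x))\<^sup>2)}"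

definition L2_norm :: "(real ^ 'd::finite) set \<Rightarrow> (real ^ 'd \<Rightarrow> 'b::euclidean_space) \<Rightarrow> real" where
  "L2_norm D v = sqrt (LINT x|lebesgue_on D. (norm (v x))\<^sup>2)"

definition is_weak_pderiv ::
  "(real ^ 'd::finite) set \<Rightarrow> 'd \<Rightarrow> (real ^ 'd \<Rightarrow> 'b::euclidean_space) \<Rightarrow> (real ^ 'd \<Rightarrow> 'b) \<Rightarrow> bool" where
  "is_weak_pderiv D i v g \<longleftrightarrow> v \<in> L2 D \<and> g \<in> L2 D \<and>
     (\<forall>\<phi>\<in>test_functions D.
        (LINT x|lebesgue_on D. (pderiv_dir i \<phi> x :: real) *\<^sub>R v x)
        = - (LINT x|lebesgue_on D. \<phi> x *\<^sub>R g x))"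

text \<open>Weak derivatives are unique up to null sets; a representative is chosen.\<close>

definition weak_pderiv ::
  "(real ^ 'd::finite) set \<Rightarrow> 'd \<Rightarrow> (real ^ 'd \<Rightarrow> 'b::euclidean_space) \<Rightarrow> real ^ 'd \<Rightarrow> 'b" where
  "weak_pderiv D i v = (SOME g. is_weak_pderiv D i v g)"

fun H_pred :: "nat \<Rightarrow> (real ^ 'd::finite) set \<Rightarrow> (real ^ 'd \<Rightarrow> 'b::euclidean_space) \<Rightarrow> bool" where
  "H_pred 0 D v \<longleftrightarrow> v \<in> L2 D"
| "H_pred (Suc k) D v \<longleftrightarrow> v \<in> L2 D \<and>
     (\<forall>i. (\<exists>g. is_weak_pderiv D i v g) \<and> H_pred k D (weak_pderiv D i v))"

definition H :: "nat \<Rightarrow> (real ^ 'd::finite) set \<Rightarrow> (real ^ 'd \<Rightarrow> 'b::euclidean_space) set" where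
  "H k D = {v. H_pred k D v}"

text \<open>
  The sum runs over all finite sequences of at most \<open>k\<close> directions rather than over multi-indices, so
  mixed derivatives are counted with multiplicity: an equivalent norm on \<open>H\<^sup>k\<close>.
\<close>

fun H_norm :: "nat \<Rightarrow> (real ^ 'd::finite) set \<Rightarrow> (real ^ 'd \<Rightarrow> 'b::euclidean_space) \<Rightarrow> real" where
  "H_norm 0 D v = L2_norm D v"
| "H_norm (Suc k) D v = sqrt ((L2_norm D v)\<^sup>2 + (\<Sum>i\<in>UNIV. (H_norm k D (weak_pderiv D i v))\<^sup>2))"

definition H01 :: "(real ^ 'd::finite) set \<Rightarrow> (real ^ 'd \<Rightarrow> 'b::euclidean_space) set" where
  "H01 D = {v\<in>H 1 D. \<exists>\<phi>. (\<forall>k::nat. \<phi> k \<in> test_functions D) \<and>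
                        (\<lambda>k. H_norm 1 D (\<lambda>x. v x - \<phi> k x)) \<longlonglongrightarrow> 0}"

definition H01_norm :: "(real ^ 'd::finite) set \<Rightarrow> (real ^ 'd \<Rightarrow> 'b::euclidean_space) \<Rightarrow> real" where
  "H01_norm D v = sqrt (\<Sum>i\<in>UNIV. (L2_norm D (weak_pderiv D i v))\<^sup>2)"

section \<open>Weak solutions and finite element spaces\<close>

text \<open>
  The variational problem posed on a space \<open>V\<close>: \<open>V = H01 D\<close> is the weak form of the boundary value
  problem, a finite element space \<open>V\<close> gives its Galerkin approximation.
\<close>

definition solves_on ::
  "(real ^ 'd::finite) set \<Rightarrow> (real ^ 'd \<Rightarrow> real) set \<Rightarrow> (real ^ 'd \<Rightarrow> real) \<Rightarrow> (real ^ 'd \<Rightarrow> real)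
     \<Rightarrow> (real ^ 'd \<Rightarrow> real) \<Rightarrow> bool" where
  "solves_on D V a f w \<longleftrightarrow> w \<in> V \<and>
     (\<forall>v\<in>V. (LINT x|lebesgue_on D. a x * (\<Sum>i\<in>UNIV. weak_pderiv D i w x * weak_pderiv D i v x))
           = (LINT x|lebesgue_on D. f x * v x))"

text \<open>
  The mesh need not exhaust \<open>D\<close>, so that domains with curved boundary are covered by inscribed meshes;
  \<open>\<sigma>\<close> is the uniformity constant of the family of meshes.
\<close>

definition uniform_mesh :: "(real ^ 'd::finite) set \<Rightarrow> real \<Rightarrow> real \<Rightarrow> (real ^ 'd) set set \<Rightarrow> bool" where
  "uniform_mesh D \<sigma> h T \<longleftrightarrow> finite T \<and>
     (\<forall>K\<in>T. polytope K \<and> K \<subseteq> closure D \<and> diameter K \<le> h \<and> (\<exists>c. ball c (\<sigma> * h) \<subseteq> K)) \<and>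
     pairwise (\<lambda>K K'. interior K \<inter> interior K' = {}) T"

definition fe_space ::
  "(real ^ 'd::finite) set \<Rightarrow> real \<Rightarrow> real \<Rightarrow> (real ^ 'd \<Rightarrow> real) set \<Rightarrow> nat \<Rightarrow> bool" where
  "fe_space D \<sigma> h V M \<longleftrightarrow>
     (\<exists>T. uniform_mesh D \<sigma> h T \<and>
        (\<forall>v\<in>V. v \<in> H01 D \<and> (\<forall>x. x \<notin> \<Union>T \<longrightarrow> v x = 0) \<and>
               (\<forall>K\<in>T. \<exists>p. real_polynomial_function p \<and> (\<forall>x\<in>K. v x = p x)))) \<and>
     (\<exists>\<phi> :: nat \<Rightarrow> real ^ 'd \<Rightarrow> real.
        V = range (\<lambda>c :: nat \<Rightarrow> real. \<lambda>x. \<Sum>i<M. c i * \<phi> i x) \<and>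
        (\<forall>c. (AE x in lebesgue_on D. (\<Sum>i<M. c i * \<phi> i x) = 0) \<longrightarrow> (\<forall>i<M. c i = 0)))"

section \<open>The parameter domain\<close>

definition Gam :: "(real ^ 'n::finite) set" where
  "Gam = {y. \<forall>n. y $ n \<in> {-1..1}}"

definition param_measure :: "(real ^ 'n::finite \<Rightarrow> real) \<Rightarrow> (real ^ 'n) measure" where
  "param_measure \<rho> = density (lebesgue_on Gam) (\<lambda>y. ennreal (\<rho> y))"

definition density_on_Gam :: "(real ^ 'n::finite \<Rightarrow> real) \<Rightarrow> bool" where
  "density_on_Gam \<rho> \<longleftrightarrow> \<rho> \<in> borel_measurable (lebesgue_on Gam) \<and> (\<forall>y\<in>Gam. 0 \<le> \<rho> y) \<and>
     prob_space (param_measure \<rho>)"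

text \<open>
  Bochner space \<open>L\<^sup>2\<^sub>\<rho>(\<Gamma>; X)\<close> for a function space \<open>X\<close> with norm \<open>nrm\<close>; strong measurability is
  approximability by simple functions almost everywhere.
\<close>

definition L2_param ::
  "(real ^ 'n::finite \<Rightarrow> real) \<Rightarrow> (real ^ 'd::finite \<Rightarrow> real) set \<Rightarrow> ((real ^ 'd \<Rightarrow> real) \<Rightarrow> real)
     \<Rightarrow> (real ^ 'n \<Rightarrow> real ^ 'd \<Rightarrow> real) set" where
  "L2_param \<rho> X nrm = {w.
     (AE y in param_measure \<rho>. w y \<in> X) \<and>
     (\<exists>S :: nat \<Rightarrow> real ^ 'n \<Rightarrow> real ^ 'd \<Rightarrow> real.
        (\<forall>k. finite (S k ` Gam) \<and> S k ` Gam \<subseteq> X \<and> (\<forall>v. S k -` {v} \<inter> Gam \<in> sets (lebesgue_on Gam))) \<and>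
        (AE y in param_measure \<rho>. (\<lambda>k. nrm (\<lambda>x. w y x - S k y x)) \<longlonglongrightarrow> 0)) \<and>
     integrable (param_measure \<rho>) (\<lambda>y. (nrm (w y))\<^sup>2)}"

definition L2_param_norm ::
  "(real ^ 'n::finite \<Rightarrow> real) \<Rightarrow> ((real ^ 'd::finite \<Rightarrow> real) \<Rightarrow> real)
     \<Rightarrow> (real ^ 'n \<Rightarrow> real ^ 'd \<Rightarrow> real) \<Rightarrow> real" where
  "L2_param_norm \<rho> nrm w = sqrt (LINT y|param_measure \<rho>. (nrm (w y))\<^sup>2)"

definition bernstein_region :: "real \<Rightarrow> complex set" where
  "bernstein_region g = {(z + inverse z) / 2 | z. 1 \<le> norm z \<and> norm z \<le> g}"

text \<open>
  Analyticity on the closed polyellipse means complex Frechet differentiability on an open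
  neighbourhood; the derivative at \<open>z\<close> is the complex-linear map sending \<open>k\<close> to \<open>\<Sum>n. k\<^sub>n A\<^sub>n\<close>, where
  the \<open>A\<^sub>n\<close> lie in the complexified space \<open>H01 D\<close>.
\<close>

definition analytic_extension ::
  "(real ^ 'd::finite) set \<Rightarrow> ('n::finite \<Rightarrow> real) \<Rightarrow> (real ^ 'n \<Rightarrow> real ^ 'd \<Rightarrow> real) \<Rightarrow> bool" where
  "analytic_extension D \<gamma> w \<longleftrightarrow>
     (\<exists>(\<Omega> :: (complex ^ 'n) set) (U :: complex ^ 'n \<Rightarrow> real ^ 'd \<Rightarrow> complex).
        open \<Omega> \<and> {z. \<forall>n. z $ n \<in> bernstein_region (\<gamma> n)} \<subseteq> \<Omega> \<and>
        (\<forall>z\<in>\<Omega>. U z \<in> H01 D) \<and>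
        (\<forall>z\<in>\<Omega>. \<exists>A :: 'n \<Rightarrow> real ^ 'd \<Rightarrow> complex. (\<forall>n. A n \<in> H01 D) \<and>
           ((\<lambda>k. H01_norm D (\<lambda>x. U (z + k) x - U z x - (\<Sum>n\<in>UNIV. k $ n * A n x)) / norm k)
              \<longlongrightarrow> 0) (at 0)) \<and>
        (\<forall>y\<in>Gam. AE x in lebesgue_on D. U (\<chi> n. complex_of_real (y $ n)) x = complex_of_real (w y x)))"

section \<open>Sparse grid interpolation\<close>

definition mpts :: "nat \<Rightarrow> nat" where
  "mpts l = (if l = 0 then 0 else if l = 1 then 1 else 2 ^ (l - 1) + 1)"

definition cc_points :: "nat \<Rightarrow> real set" where
  "cc_points l = (if l = 0 then {} else if l = 1 then {0}
     else (\<lambda>j. - cos (pi * (real j - 1) / (real (mpts l) - 1))) ` {1..mpts l})"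

definition lagrange :: "nat \<Rightarrow> real \<Rightarrow> real \<Rightarrow> real" where
  "lagrange l p t = (if p \<in> cc_points l then \<Prod>q\<in>cc_points l - {p}. (t - q) / (p - q) else 0)"

definition interp1 :: "nat \<Rightarrow> (real \<Rightarrow> real) \<Rightarrow> real \<Rightarrow> real" where
  "interp1 l g t = (\<Sum>p\<in>cc_points l. g p * lagrange l p t)"

text \<open>
  The tensor product of the differences \<open>interp1 l\<^sub>n - interp1 (l\<^sub>n - 1)\<close>, applied to a family \<open>v\<close> of
  functions of \<open>x\<close>; \<open>tensor_diff_prod\<close> below is its characterisation on products.
\<close>

definition tensor_diff ::
  "('n::finite \<Rightarrow> nat) \<Rightarrow> (real ^ 'n \<Rightarrow> 'x \<Rightarrow> real) \<Rightarrow> real ^ 'n \<Rightarrow> 'x \<Rightarrow> real" where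
  "tensor_diff l v y x =
     (\<Sum>p\<in>(\<Pi>\<^sub>E n\<in>UNIV. cc_points (l n) \<union> cc_points (l n - 1)).
        v (\<chi> n. p n) x * (\<Prod>n\<in>UNIV. lagrange (l n) (p n) (y $ n) - lagrange (l n - 1) (p n) (y $ n)))"

definition level_indices :: "nat \<Rightarrow> ('n::finite \<Rightarrow> nat) set" where
  "level_indices L = {l. (\<forall>n. 1 \<le> l n) \<and> (\<Sum>n\<in>UNIV. l n - 1) \<le> L}"

definition sparse_interp ::
  "nat \<Rightarrow> (real ^ 'n::finite \<Rightarrow> 'x \<Rightarrow> real) \<Rightarrow> real ^ 'n \<Rightarrow> 'x \<Rightarrow> real" where
  "sparse_interp L v y x = (\<Sum>l\<in>level_indices L. tensor_diff l v y x)"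

definition sparse_grid :: "nat \<Rightarrow> (real ^ 'n::finite) set" where
  "sparse_grid L = {y. \<exists>l :: 'n \<Rightarrow> nat. (\<forall>n. 1 \<le> l n) \<and> (\<Sum>n\<in>UNIV. l n - 1) = L \<and>
                                       (\<forall>n. y $ n \<in> cc_points (l n))}"

definition new_points :: "nat \<Rightarrow> (real ^ 'n::finite) set" where
  "new_points L = (if L = 1 then sparse_grid 1 else sparse_grid L - sparse_grid (L - 1))"

text \<open>The argument of type \<open>'n itself\<close> only fixes the number \<open>CARD('n)\<close> of parameters.\<close>

definition num_points :: "'n::finite itself \<Rightarrow> nat \<Rightarrow> nat" where
  "num_points _ L = (if L = 0 then 1 else card (sparse_grid L :: (real ^ 'n) set))"

definition num_new_points :: "'n::finite itself \<Rightarrow> nat \<Rightarrow> nat" where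
  "num_new_points _ L = card (new_points L :: (real ^ 'n) set)"

lemma finite_cc_points: "finite (cc_points l)"
  by (simp add: cc_points_def)

lemma finite_level_indices: "finite (level_indices L :: ('n::finite \<Rightarrow> nat) set)"
proof (rule finite_subset)
  show "(level_indices L :: ('n \<Rightarrow> nat) set) \<subseteq> (\<Pi>\<^sub>E n\<in>UNIV. {..L + 1})"
  proof
    fix l :: "'n \<Rightarrow> nat" assume "l \<in> level_indices L"
    then have s: "(\<Sum>n\<in>UNIV. l n - 1) \<le> L" by (simp add: level_indices_def)
    have "l n \<le> L + 1" for n
      using member_le_sum[of n UNIV "\<lambda>n. l n - 1"] s by simp
    then show "l \<in> (\<Pi>\<^sub>E n\<in>UNIV. {..L + 1})" by auto
  qed
  show "finite (\<Pi>\<^sub>E n\<in>(UNIV :: 'n set). {..L + 1})"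
    by (intro finite_PiE) auto
qed

lemma finite_sparse_grid: "finite (sparse_grid L :: (real ^ 'n::finite) set)"
proof (rule finite_subset)
  let ?B = "\<lambda>l :: 'n \<Rightarrow> nat. (\<lambda>p. \<chi> n. p n) ` (\<Pi>\<^sub>E n\<in>UNIV. cc_points (l n))"
  show "(sparse_grid L :: (real ^ 'n) set) \<subseteq> (\<Union>l\<in>level_indices L. ?B l)"
  proof
    fix y :: "real ^ 'n" assume "y \<in> sparse_grid L"
    then obtain l :: "'n \<Rightarrow> nat" where l: "\<forall>n. 1 \<le> l n" "(\<Sum>n\<in>UNIV. l n - 1) = L"
      "\<forall>n. y $ n \<in> cc_points (l n)" by (auto simp: sparse_grid_def)
    have "y = (\<chi> n. y $ n)" by (simp add: vec_eq_iff)
    then have "y \<in> ?B l" using l(3) by (intro image_eqI[where x = "\<lambda>n. y $ n"]) auto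
    then show "y \<in> (\<Union>l\<in>level_indices L. ?B l)" using l(1,2) by (auto simp: level_indices_def)
  qed
  show "finite (\<Union>l\<in>level_indices L. ?B l)"
    by (intro finite_UN_I finite_level_indices finite_imageI finite_PiE) (auto simp: finite_cc_points)
qed

lemma card_sparse_grid_0: "card (sparse_grid 0 :: (real ^ 'n::finite) set) = 1"
proof -
  have "(sparse_grid 0 :: (real ^ 'n) set) = {0}"
  proof (intro equalityI subsetI)
    fix y :: "real ^ 'n" assume "y \<in> sparse_grid 0"
    then obtain l :: "'n \<Rightarrow> nat" where "\<forall>n. 1 \<le> l n" "\<forall>n. l n - 1 = 0"
      and c: "\<forall>n. y $ n \<in> cc_points (l n)" by (auto simp: sparse_grid_def)
    then have "\<forall>n. l n = 1" by (metis diff_is_0_eq le_antisym)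
    with c show "y \<in> {0}" by (simp add: cc_points_def vec_eq_iff)
  next
    fix y :: "real ^ 'n" assume "y \<in> {0}"
    then show "y \<in> sparse_grid 0"
      unfolding sparse_grid_def by (auto simp: cc_points_def intro!: exI[of _ "\<lambda>_. 1"])
  qed
  then show ?thesis by simp
qed

lemma tensor_diff_prod:
  "tensor_diff l (\<lambda>y x. c x * (\<Prod>n\<in>UNIV. g n (y $ n))) y x
   = c x * (\<Prod>n\<in>UNIV. interp1 (l n) (g n) (y $ n) - interp1 (l n - 1) (g n) (y $ n))"
proof -
  let ?P = "\<lambda>n. cc_points (l n) \<union> cc_points (l n - 1)"
  have e: "interp1 k (g n) t = (\<Sum>p\<in>?P n. g n p * lagrange k p t)" if "k = l n \<or> k = l n - 1" for k n t
    unfolding interp1_def using that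
    by (intro sum.mono_neutral_left) (auto simp: finite_cc_points lagrange_def)
  have "(\<Prod>n\<in>UNIV. interp1 (l n) (g n) (y $ n) - interp1 (l n - 1) (g n) (y $ n))
      = (\<Prod>n\<in>UNIV. \<Sum>p\<in>?P n. g n p * (lagrange (l n) p (y $ n) - lagrange (l n - 1) p (y $ n)))"
    by (simp add: e sum_subtractf right_diff_distrib)
  also have "\<dots> = (\<Sum>p\<in>(\<Pi>\<^sub>E n\<in>UNIV. ?P n).
      \<Prod>n\<in>UNIV. g n (p n) * (lagrange (l n) (p n) (y $ n) - lagrange (l n - 1) (p n) (y $ n)))"
    by (intro prod_sum_PiE) (auto simp: finite_cc_points)
  finally show ?thesis
    by (simp add: tensor_diff_def prod.distrib sum_distrib_left mult.assoc)
qed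

section \<open>Interpolation cost\<close>

definition mesh_size :: "real \<Rightarrow> nat \<Rightarrow> real \<Rightarrow> real" where
  "mesh_size C_fem s \<epsilon> = (\<epsilon> / (3 * C_fem)) powr (1 / real s)"

definition L_max :: "nat \<Rightarrow> real \<Rightarrow> real \<Rightarrow> real \<Rightarrow> real" where
  "L_max N r C_sc \<epsilon> = real N / ln 2 * ln (1 / (r * real N) * ln (3 * C_sc / \<epsilon>))"

text \<open>
  The upper limit \<open>Lm\<close> is real.  The levels run up to its ceiling; since the summands are nonnegative,
  upper bounds for this sum also hold for the sum over the levels \<open>L \<le> Lm\<close>, and the two sums agree
  whenever \<open>Lm\<close> is a natural number.
\<close>

definition interp_cost :: "'n::finite itself \<Rightarrow> nat \<Rightarrow> real \<Rightarrow> real" where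
  "interp_cost N Mh Lm = (\<Sum>L = 1..nat \<lceil>Lm\<rceil>.
     real Mh * real (num_new_points N L) * (2 * real (num_points N (L - 1)) - 1))"

definition C2 :: "nat \<Rightarrow> real \<Rightarrow> real" where
  "C2 N r = 1 + 1 / ln 2 * ln (1 / (r * real N))"

definition C8 :: "nat \<Rightarrow> real" where
  "C8 N = 64 * exp (2 * (real N - 1))"

end

theory Submission
  imports Defs
begin

text \<open>
  Write \<open>N\<close> for the number of parameters and \<open>K\<close> for the last level.  Because the Clenshaw--Curtis
  points are nested, every grid point has in each coordinate a first level at which it appears, and
  a point belongs to the sparse grid of level \<open>L\<close> exactly when these first levels, counted from zero,
  add up to at most \<open>L\<close>.  At most \<open>2\<^sup>k\<close> one-dimensional points appear first at level \<open>k\<close>, so each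
  multi-index \<open>k\<close> of sum \<open>j\<close> contributes at most \<open>2\<^sup>j\<close> points.  The number of such multi-indices
  is \<open>j + N - 1\<close> choose \<open>N - 1\<close>, which Stirling's bound \<open>(n + 1)\<^sup>n \<le> e\<^sup>n n!\<close> estimates by
  \<open>B j = e\<^bsup>N-1\<^esup> (1 + j / N)\<^bsup>N-1\<^esup>\<close> (\<open>card_multi_indices_le\<close>).

  Hence \<open>2\<^sup>L B L\<close> bounds the new points, for \<open>L \<ge> 2\<close>, and \<open>2\<^bsup>L+1\<^esup> B L\<close> all points of level \<open>L\<close>.  Every level
  costs at most \<open>2 \<cdot> 4\<^sup>L B K B (K - 1)\<close> per component of the coefficient vectors, and a geometric sum
  gives a total of \<open>(8/3) 4\<^sup>K B K B (K - 1)\<close> (\<open>interp_cost_le_shell_bound\<close>).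

  Rounding the real number \<open>L_max\<close> up to \<open>K\<close> increases it by less than one.  This costs a factor
  \<open>4\<close> in \<open>4\<^sup>K\<close> and a factor at most \<open>e < 3\<close> in \<open>B K\<close>, so that the constant becomes
  \<open>32 \<le> 64\<close>.  The right-hand side of the theorem is this bound in another notation: with
  \<open>\<Lambda> = ln (3 C_sc / \<epsilon>) / (r N)\<close> one has \<open>2 powr L_max = \<Lambda>\<^sup>N\<close>, and the expression in braces is
  \<open>1 + ln \<Lambda> / ln 2 = 1 + L_max / N\<close>.  These identities need \<open>r > 0\<close>, which holds
  because the Bernstein radii exceed one, and small \<open>\<epsilon>\<close> makes \<open>\<Lambda> \<ge> 1\<close>, that is, \<open>L_max \<ge> 0\<close>.
\<close>

section \<open>Nested Clenshaw--Curtis points\<close>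

lemma cc_points_mono_Suc: "cc_points l \<subseteq> cc_points (Suc l)"
proof -
  consider "l = 0" | "l = 1" | "l \<ge> 2" by linarith
  then show ?thesis
  proof cases
    case 1
    then show ?thesis by (simp add: cc_points_def)
  next
    case 2
    have "(0::real) = - cos (pi * (real 2 - 1) / (real (mpts 2) - 1))"
      by (simp add: mpts_def)
    moreover have "(2::nat) \<in> {1..mpts 2}" by (simp add: mpts_def)
    ultimately have "(0::real)
        \<in> (\<lambda>j. - cos (pi * (real j - 1) / (real (mpts 2) - 1))) ` {1..mpts 2}"
      by (rule image_eqI)
    then have "(0::real) \<in> cc_points 2" by (simp add: cc_points_def)
    then show ?thesis using 2 by (simp add: cc_points_def numeral_2_eq_2)
  next
    case 3
    show ?thesis
    proof
      fix t assume "t \<in> cc_points l"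
      with 3 obtain j where j: "j \<in> {1..mpts l}"
        and t: "t = - cos (pi * (real j - 1) / (real (mpts l) - 1))"
        by (auto simp: cc_points_def)
      \<comment> \<open>The mesh of angles is halved, so the point number \<open>j - 1\<close> gets the number \<open>2 (j - 1)\<close>.\<close>
      have p: "(2::nat) ^ l = 2 * 2 ^ (l - 1)"
        using 3 by (metis One_nat_def Suc_pred less_le_trans pos2 power_Suc)
      have "real (2 * j - 1) - 1 = 2 * (real j - 1)"
        using j by (simp add: of_nat_diff)
      moreover have "real (mpts (Suc l)) - 1 = 2 * (real (mpts l) - 1)"
        using 3 arg_cong[OF p, of real] by (simp add: mpts_def)
      moreover have "pi * (2 * x) / (2 * y) = pi * x / y" for x y :: real by simp
      ultimately have "t = - cos (pi * (real (2 * j - 1) - 1) / (real (mpts (Suc l)) - 1))"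
        unfolding t by (simp only:)
      moreover have "2 * j - 1 \<in> {1..mpts (Suc l)}"
        using j 3 p by (auto simp: mpts_def)
      ultimately show "t \<in> cc_points (Suc l)"
        using 3 unfolding cc_points_def by auto
    qed
  qed
qed

lemma zero_in_cc_points: "1 \<le> l \<Longrightarrow> 0 \<in> cc_points l"
proof (induction l rule: dec_induct)
  case base
  then show ?case by (simp add: cc_points_def)
next
  case (step l)
  then show ?case using cc_points_mono_Suc by blast
qed

text \<open>
  The point \<open>0\<close> is present from the first level on, which leaves at most \<open>2\<^sup>k\<close> of the
  \<open>2\<^sup>k + 1\<close> points to be new.  The crude factor \<open>2\<^sup>k\<close> (instead of \<open>2\<^bsup>k-1\<^esup>\<close> for large \<open>k\<close>) is uniform in \<open>k\<close>, which makes the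
  number of points multiplicative in several dimensions.
\<close>

lemma card_cc_points_diff_le: "card (cc_points (Suc k) - cc_points k) \<le> 2 ^ k"
proof (cases "k = 0")
  case True
  then show ?thesis by (simp add: cc_points_def)
next
  case False
  have "cc_points (Suc k) - cc_points k \<subseteq> cc_points (Suc k) - {0}"
    using zero_in_cc_points[of k] False by auto
  then have "card (cc_points (Suc k) - cc_points k) \<le> card (cc_points (Suc k) - {0})"
    by (intro card_mono) (auto simp: finite_cc_points)
  also have "\<dots> = card (cc_points (Suc k)) - 1"
    using zero_in_cc_points[of "Suc k"] by simp
  also have "card (cc_points (Suc k)) \<le> card {1..mpts (Suc k)}"
    using False card_image_le[of "{1..mpts (Suc k)}"] by (simp add: cc_points_def)
  also have "card {1..mpts (Suc k)} - 1 = 2 ^ k"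
    using False by (simp add: mpts_def)
  finally show ?thesis by simp
qed

section \<open>Counting sparse grid points by their first level\<close>

text \<open>
  The points whose coordinate number \<open>n\<close> has first level \<open>k n\<close>; levels are counted from zero here,
  so that they add up to the level of the sparse grid.
\<close>

definition shell :: "('n::finite \<Rightarrow> nat) \<Rightarrow> (real ^ 'n) set" where
  "shell k = {y. \<forall>n. y $ n \<in> cc_points (Suc (k n)) - cc_points (k n)}"

lemma finite_shell: "finite (shell k)"
  and card_shell_le: "card (shell k) \<le> 2 ^ (\<Sum>n\<in>UNIV. k n)"
proof -
  let ?P = "\<Pi>\<^sub>E n\<in>UNIV. cc_points (Suc (k n)) - cc_points (k n)"
  have fin: "finite ?P" by (intro finite_PiE) (auto simp: finite_cc_points)
  have sub: "shell k \<subseteq> (\<lambda>p. \<chi> n. p n) ` ?P"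
  proof
    fix y assume "y \<in> shell k"
    then show "y \<in> (\<lambda>p. \<chi> n. p n) ` ?P"
      by (intro image_eqI[where x = "\<lambda>n. y $ n"]) (auto simp: shell_def vec_eq_iff)
  qed
  then show "finite (shell k)" using fin finite_surj by blast
  have "card (shell k) \<le> card ?P"
    using surj_card_le[OF fin sub] .
  also have "\<dots> = (\<Prod>n\<in>UNIV. card (cc_points (Suc (k n)) - cc_points (k n)))"
    by (simp add: card_PiE)
  also have "\<dots> \<le> (\<Prod>n\<in>UNIV. 2 ^ k n)"
    by (intro prod_mono) (auto intro: card_cc_points_diff_le)
  finally show "card (shell k) \<le> 2 ^ (\<Sum>n\<in>UNIV. k n)"
    by (simp add: power_sum)
qed

definition multi_indices :: "nat \<Rightarrow> ('n::finite \<Rightarrow> nat) set" where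
  "multi_indices j = {k. (\<Sum>n\<in>UNIV. k n) = j}"

lemma finite_multi_indices: "finite (multi_indices j :: ('n::finite \<Rightarrow> nat) set)"
  and card_multi_indices_le_binomial:
    "card (multi_indices j :: ('n::finite \<Rightarrow> nat) set) \<le> (j + CARD('n) - 1) choose j"
proof -
  obtain xs :: "'n list" where xs: "set xs = UNIV" "distinct xs"
    using finite_distinct_list[OF finite[of UNIV]] by auto
  let ?Q = "{l :: nat list. size l = CARD('n) \<and> sum_list l = j}"
  have len: "length xs = CARD('n)" using distinct_card[OF xs(2)] xs(1) by simp
  have inj: "inj (\<lambda>k :: 'n \<Rightarrow> nat. map k xs)"
    using xs(1) by (auto intro!: injI)
  have sub: "(\<lambda>k :: 'n \<Rightarrow> nat. map k xs) ` multi_indices j \<subseteq> ?Q"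
    using xs by (auto simp: multi_indices_def len sum_list_distinct_conv_sum_set)
  have "?Q \<subseteq> {l. set l \<subseteq> {..j} \<and> length l = CARD('n)}"
    by (auto intro: member_le_sum_list)
  then have fin: "finite ?Q" using finite_lists_length_eq[of "{..j}"] finite_subset by blast
  show "finite (multi_indices j :: ('n \<Rightarrow> nat) set)"
    by (rule inj_on_finite[OF inj_on_subset[OF inj] sub fin]) simp
  have "card (multi_indices j :: ('n \<Rightarrow> nat) set) \<le> card ?Q"
    by (rule card_inj_on_le[OF inj_on_subset[OF inj] sub fin]) simp
  then show "card (multi_indices j :: ('n \<Rightarrow> nat) set) \<le> (j + CARD('n) - 1) choose j"
    by (simp add: card_length_sum_list)
qed

text \<open>Replacing each level by the first level at which the coordinate appears lowers the sum.\<close>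

lemma in_shell_of_cc_points:
  fixes y :: "real ^ 'n::finite"
  assumes "\<And>n. y $ n \<in> cc_points (l n)"
  obtains k where "y \<in> shell k" "\<And>n. k n \<le> l n - 1"
proof
  define k where "k n = (LEAST i. y $ n \<in> cc_points (Suc i))" for n
  have pos: "l n > 0" for n
    using assms[of n] by (cases "l n") (auto simp: cc_points_def)
  have in_l: "y $ n \<in> cc_points (Suc (l n - 1))" for n
    using assms[of n] pos[of n] by simp
  show "k n \<le> l n - 1" for n
    unfolding k_def using in_l by (rule Least_le)
  have "y $ n \<in> cc_points (Suc (k n))" for n
    unfolding k_def using in_l by (rule LeastI)
  moreover have "y $ n \<notin> cc_points (k n)" for n
  proof (cases "k n")
    case 0
    then show ?thesis by (simp add: cc_points_def)
  next
    case (Suc i)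
    then have "i < (LEAST i. y $ n \<in> cc_points (Suc i))" by (simp add: k_def)
    then show ?thesis using not_less_Least Suc by metis
  qed
  ultimately show "y \<in> shell k" by (simp add: shell_def)
qed

text \<open>
  Grids are defined with levels of sum exactly \<open>L\<close>, so a point that appears earlier has to be lifted
  by raising one of its levels; nestedness keeps it in the grid.
\<close>

lemma sparse_grid_mono_Suc:
  "(sparse_grid L :: (real ^ 'n::finite) set) \<subseteq> sparse_grid (Suc L)"
proof
  fix y :: "real ^ 'n" assume "y \<in> sparse_grid L"
  then obtain l :: "'n \<Rightarrow> nat" where l: "\<And>n. 1 \<le> l n" "(\<Sum>n\<in>UNIV. l n - 1) = L"
    "\<And>n. y $ n \<in> cc_points (l n)" by (auto simp: sparse_grid_def)
  obtain m :: 'n where True by blast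
  let ?l = "l(m := Suc (l m))"
  have "(\<Sum>n\<in>UNIV. ?l n - 1) = (?l m - 1) + (\<Sum>n\<in>UNIV - {m}. ?l n - 1)"
    by (rule sum.remove) auto
  also have "\<dots> = Suc ((l m - 1) + (\<Sum>n\<in>UNIV - {m}. l n - 1))"
    using l(1)[of m] by simp
  also have "(l m - 1) + (\<Sum>n\<in>UNIV - {m}. l n - 1) = L"
    using sum.remove[of UNIV m "\<lambda>n. l n - 1"] l(2) by simp
  finally have "(\<Sum>n\<in>UNIV. ?l n - 1) = Suc L" .
  moreover have "\<forall>n. 1 \<le> ?l n" using l(1) by simp
  moreover have "\<forall>n. y $ n \<in> cc_points (?l n)"
    using l(3) cc_points_mono_Suc by auto
  ultimately show "y \<in> sparse_grid (Suc L)"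
    unfolding sparse_grid_def by blast
qed

lemma shell_subset_sparse_grid:
  assumes "k \<in> multi_indices j"
  shows "shell k \<subseteq> sparse_grid j"
  using assms by (auto simp: shell_def sparse_grid_def multi_indices_def
      intro!: exI[of _ "\<lambda>n. Suc (k n)"])

lemma sparse_grid_subset_shells:
  "(sparse_grid L :: (real ^ 'n::finite) set) \<subseteq> (\<Union>j\<le>L. \<Union>k\<in>multi_indices j. shell k)"
proof
  fix y :: "real ^ 'n" assume "y \<in> sparse_grid L"
  then obtain l :: "'n \<Rightarrow> nat" where l: "(\<Sum>n\<in>UNIV. l n - 1) = L" "\<And>n. y $ n \<in> cc_points (l n)"
    by (auto simp: sparse_grid_def)
  obtain k where k: "y \<in> shell k" "\<And>n. k n \<le> l n - 1"
    using in_shell_of_cc_points l(2) by metis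
  have "(\<Sum>n\<in>UNIV. k n) \<le> L"
    unfolding l(1)[symmetric] by (intro sum_mono k(2))
  with k(1) show "y \<in> (\<Union>j\<le>L. \<Union>k\<in>multi_indices j. shell k)"
    by (auto simp: multi_indices_def)
qed

lemma sparse_grid_diff_subset_shells:
  "(sparse_grid (Suc L) - sparse_grid L :: (real ^ 'n::finite) set)
     \<subseteq> (\<Union>k\<in>multi_indices (Suc L). shell k)"
proof
  fix y :: "real ^ 'n" assume y: "y \<in> sparse_grid (Suc L) - sparse_grid L"
  then obtain j and k :: "'n \<Rightarrow> nat"
    where k: "j \<le> Suc L" "k \<in> multi_indices j" "y \<in> shell k"
    using sparse_grid_subset_shells by blast
  have "sparse_grid j \<subseteq> (sparse_grid L :: (real ^ 'n) set)" if "j \<le> L"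
    using that sparse_grid_mono_Suc by (rule lift_Suc_mono_le[rotated])
  with y k shell_subset_sparse_grid[OF k(2)] have "j = Suc L"
    by (metis DiffD2 le_SucE subsetD)
  with k show "y \<in> (\<Union>k\<in>multi_indices (Suc L). shell k)" by blast
qed

section \<open>Growth of the number of points\<close>

text \<open>
  An upper bound for the number of multi-indices of sum \<open>x\<close>.  The argument is real because the
  bound is finally evaluated at the unrounded last level.
\<close>

definition shell_bound :: "nat \<Rightarrow> real \<Rightarrow> real" where
  "shell_bound N x = exp (real N - 1) * (1 + x / real N) ^ (N - 1)"

lemma shell_bound_mono: "0 \<le> x \<Longrightarrow> x \<le> y \<Longrightarrow> shell_bound N x \<le> shell_bound N y"
  unfolding shell_bound_def
  by (intro mult_left_mono power_mono add_left_mono divide_right_mono add_nonneg_nonneg) auto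

lemma shell_bound_ge_1: "1 \<le> N \<Longrightarrow> 0 \<le> x \<Longrightarrow> 1 \<le> shell_bound N x"
  unfolding shell_bound_def
  using mult_mono[of 1 "exp (real N - 1)" 1 "(1 + x / real N) ^ (N - 1)"] by simp

text \<open>
  The prefactor \<open>e\<^bsup>N-1\<^esup>\<close> of \<open>shell_bound\<close> is independent of \<open>x\<close>, and the other factor grows by at
  most \<open>(1 + 1 / N)\<^bsup>N-1\<^esup> \<le> e\<close> per unit step.
\<close>

lemma shell_bound_add_1_le:
  assumes N: "1 \<le> N" and x: "0 \<le> x"
  shows "shell_bound N (x + 1) \<le> 3 * shell_bound N x"
proof -
  have "(1 + (x + 1) / real N) \<le> (1 + x / real N) * (1 + 1 / real N)"
    using N x by (simp add: field_simps)
  then have "(1 + (x + 1) / real N) ^ (N - 1) \<le> ((1 + x / real N) * (1 + 1 / real N)) ^ (N - 1)"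
    using x by (intro power_mono) auto
  also have "\<dots> = (1 + x / real N) ^ (N - 1) * (1 + 1 / real N) ^ (N - 1)"
    by (simp add: power_mult_distrib)
  also have "(1 + 1 / real N) ^ (N - 1) \<le> (1 + 1 / real N) ^ N"
    by (intro power_increasing) auto
  also have "(1 + 1 / real N) ^ N \<le> exp 1"
    using N by (intro exp_ge_one_plus_x_over_n_power_n) auto
  also have "exp 1 \<le> (3::real)" by (rule exp_le)
  finally have "(1 + (x + 1) / real N) ^ (N - 1) \<le> (1 + x / real N) ^ (N - 1) * 3"
    using x by (simp add: mult_left_mono)
  then show ?thesis
    unfolding shell_bound_def by (simp add: mult_left_mono)
qed

text \<open>
  This is the form \<open>N! \<ge> e (N / e)\<^sup>N\<close> of Stirling's bound for \<open>N = n + 1\<close>; going from \<open>n\<close> to \<open>n + 1\<close>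
  multiplies the quotient of the two sides by \<open>(1 + 1 / (n + 1))\<^bsup>n+1\<^esup> / e \<le> 1\<close>.
\<close>

lemma Suc_power_le_exp_fact: "real (Suc n) ^ n \<le> exp (real n) * fact n"
proof (induction n)
  case 0
  then show ?case by simp
next
  case (Suc n)
  have "real (Suc (Suc n)) = real (Suc n) * (1 + 1 / real (Suc n))"
    by (simp add: field_simps)
  then have "real (Suc (Suc n)) ^ Suc n
      = real (Suc n) ^ n * real (Suc n) * (1 + 1 / real (Suc n)) ^ Suc n"
    by (simp only: power_mult_distrib power_Suc mult_ac)
  also have "\<dots> \<le> exp (real n) * fact n * real (Suc n) * exp 1"
    by (intro mult_mono Suc.IH exp_ge_one_plus_x_over_n_power_n) auto
  also have "\<dots> = exp (real (Suc n)) * fact (Suc n)"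
    by (simp add: exp_add algebra_simps)
  finally show ?case .
qed

text \<open>
  Writing the binomial coefficient as a product of \<open>n\<close> factors below \<open>n + 1 + j\<close> over \<open>n!\<close> pulls out
  \<open>(n + 1)\<^sup>n / n! \<le> e\<^sup>n\<close>, where \<open>n = N - 1\<close>.  The sharper estimate of the factors by \<open>n + j\<close> would
  leave \<open>1 + j / (N - 1)\<close> instead of the quotient \<open>j / N\<close> that matches \<open>L_max / N\<close>.
\<close>

lemma binomial_le_shell_bound:
  assumes N: "1 \<le> N"
  shows "real ((j + N - 1) choose j) \<le> shell_bound N (real j)"
proof -
  obtain n where n: "N = Suc n" using N by (cases N) auto
  have "real ((j + n) choose n) * fact n \<le> real ((j + n) ^ n)"
    using binomial_fact_pow[of "j + n" n]
    by (metis of_nat_fact of_nat_le_iff of_nat_mult)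
  also have "\<dots> \<le> real (Suc n + j) ^ n"
    unfolding of_nat_power by (intro power_mono) auto
  also have "real (Suc n + j) = real (Suc n) * (1 + real j / real (Suc n))"
    by (simp add: field_simps)
  also have "\<dots> ^ n \<le> exp (real n) * fact n * (1 + real j / real (Suc n)) ^ n"
    unfolding power_mult_distrib by (intro mult_right_mono Suc_power_le_exp_fact) auto
  finally have "real ((j + n) choose n) \<le> exp (real n) * (1 + real j / real (Suc n)) ^ n"
    by (simp add: mult_ac)
  moreover have "(j + n) choose j = (j + n) choose n"
    using binomial_symmetric[of j "j + n"] by simp
  ultimately show ?thesis by (simp add: n shell_bound_def)
qed

lemma card_multi_indices_le:
  "real (card (multi_indices j :: ('n::finite \<Rightarrow> nat) set)) \<le> shell_bound CARD('n) (real j)"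
  using card_multi_indices_le_binomial[where 'n = 'n and j = j]
    binomial_le_shell_bound[of "CARD('n)" j]
  by (simp add: Suc_leI order_trans[OF of_nat_mono])

lemma card_shells_le:
  "real (card (\<Union>k\<in>(multi_indices j :: ('n::finite \<Rightarrow> nat) set). shell k))
     \<le> 2 ^ j * shell_bound CARD('n) (real j)"
proof -
  have "card (\<Union>k\<in>(multi_indices j :: ('n \<Rightarrow> nat) set). shell k)
      \<le> (\<Sum>k\<in>(multi_indices j :: ('n \<Rightarrow> nat) set). card (shell k))"
    by (rule card_UN_le[OF finite_multi_indices])
  also have "\<dots> \<le> (\<Sum>k\<in>(multi_indices j :: ('n \<Rightarrow> nat) set). 2 ^ j)"
  proof (rule sum_mono)
    fix k :: "'n \<Rightarrow> nat" assume "k \<in> multi_indices j"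
    then show "card (shell k) \<le> 2 ^ j"
      using card_shell_le[of k] by (simp add: multi_indices_def)
  qed
  finally have "card (\<Union>k\<in>(multi_indices j :: ('n \<Rightarrow> nat) set). shell k)
      \<le> 2 ^ j * card (multi_indices j :: ('n \<Rightarrow> nat) set)" by (simp add: mult.commute)
  then have "real (card (\<Union>k\<in>(multi_indices j :: ('n \<Rightarrow> nat) set). shell k))
      \<le> 2 ^ j * real (card (multi_indices j :: ('n \<Rightarrow> nat) set))"
    by (metis of_nat_le_iff of_nat_mult of_nat_numeral of_nat_power)
  also have "\<dots> \<le> 2 ^ j * shell_bound CARD('n) (real j)"
    by (intro mult_left_mono card_multi_indices_le) auto
  finally show ?thesis .
qed

lemma card_sparse_grid_le:
  "real (card (sparse_grid L :: (real ^ 'n::finite) set)) \<le> 2 ^ (L + 1) * shell_bound CARD('n) (real L)"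
proof -
  let ?S = "\<lambda>j. \<Union>k\<in>(multi_indices j :: ('n \<Rightarrow> nat) set). shell k"
  have "card (sparse_grid L :: (real ^ 'n) set) \<le> card (\<Union>j\<le>L. ?S j)"
    by (intro card_mono sparse_grid_subset_shells finite_UN_I finite_multi_indices finite_shell) auto
  also have "\<dots> \<le> (\<Sum>j\<le>L. card (?S j))"
    by (rule card_UN_le) simp
  finally have "real (card (sparse_grid L :: (real ^ 'n) set)) \<le> (\<Sum>j\<le>L. real (card (?S j)))"
    by (metis of_nat_le_iff of_nat_sum)
  also have "\<dots> \<le> (\<Sum>j\<le>L. 2 ^ j * shell_bound CARD('n) (real L))"
  proof (rule sum_mono)
    fix j assume "j \<in> {..L}"
    then show "real (card (?S j)) \<le> 2 ^ j * shell_bound CARD('n) (real L)"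
      by (intro order_trans[OF card_shells_le] mult_left_mono shell_bound_mono) auto
  qed
  also have "\<dots> = (\<Sum>j\<le>L. 2 ^ j) * shell_bound CARD('n) (real L)"
    by (simp add: sum_distrib_right)
  also have "\<dots> \<le> 2 ^ (L + 1) * shell_bound CARD('n) (real L)"
  proof (rule mult_right_mono)
    have "(\<Sum>j\<le>L. (2::real) ^ j) = 2 ^ (L + 1) - 1"
      by (induction L) auto
    then show "(\<Sum>j\<le>L. (2::real) ^ j) \<le> 2 ^ (L + 1)" by simp
    show "0 \<le> shell_bound CARD('n) (real L)" by (simp add: shell_bound_def)
  qed
  finally show ?thesis .
qed

lemma num_points_le: "real (num_points TYPE('n::finite) L) \<le> 2 ^ (L + 1) * shell_bound CARD('n) (real L)"
  using card_sparse_grid_le[where 'n = 'n and L = L] shell_bound_ge_1[of "CARD('n)" 0]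
  by (simp add: num_points_def Suc_leI)

lemma num_new_points_le:
  assumes "2 \<le> L"
  shows "real (num_new_points TYPE('n::finite) L) \<le> 2 ^ L * shell_bound CARD('n) (real L)"
proof -
  obtain K where K: "L = Suc K" "L \<noteq> 1" using assms by (cases L) auto
  have "num_new_points TYPE('n) L \<le> card (\<Union>k\<in>(multi_indices L :: ('n \<Rightarrow> nat) set). shell k)"
    unfolding num_new_points_def new_points_def using K sparse_grid_diff_subset_shells[of K]
    by (auto intro!: card_mono finite_UN_I finite_multi_indices finite_shell)
  then show ?thesis using card_shells_le[where 'n = 'n and j = L] by linarith
qed

section \<open>Summation over the levels\<close>

lemma level_cost_le:
  assumes "1 \<le> L"
  shows "real (num_new_points TYPE('n::finite) L) * (2 * real (num_points TYPE('n) (L - 1)) - 1)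
           \<le> 2 * 4 ^ L * shell_bound CARD('n) (real L) * shell_bound CARD('n) (real (L - 1))"
    (is "?l \<le> ?r")
proof (cases "L = 1")
  \<comment> \<open>All \<open>2 N + 1\<close> points of the first level count as new, including the one of level zero, so
    the bound for new points does not apply here.\<close>
  case True
  have "?l = real (card (sparse_grid 1 :: (real ^ 'n) set))"
    using True by (simp add: num_new_points_def new_points_def num_points_def)
  also have "\<dots> \<le> 4 * shell_bound CARD('n) 1"
    using card_sparse_grid_le[where 'n = 'n and L = 1] by simp
  also have "\<dots> \<le> 8 * shell_bound CARD('n) 1 * shell_bound CARD('n) 0"
  proof -
    have "1 \<le> shell_bound CARD('n) 0" "1 \<le> shell_bound CARD('n) 1"
      by (auto intro!: shell_bound_ge_1 simp: Suc_leI)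
    then show ?thesis
      using mult_left_mono[of 1 "shell_bound CARD('n) 0" "8 * shell_bound CARD('n) 1"] by simp
  qed
  finally show ?thesis using True by simp
next
  case False
  then have L: "2 \<le> L" using assms by simp
  have "?l \<le> real (num_new_points TYPE('n) L) * (2 * real (num_points TYPE('n) (L - 1)))"
    by (intro mult_left_mono) auto
  also have "\<dots> \<le> (2 ^ L * shell_bound CARD('n) (real L))
                 * (2 * (2 ^ (L - 1 + 1) * shell_bound CARD('n) (real (L - 1))))"
    by (intro mult_mono num_new_points_le L num_points_le)
      (auto simp: shell_bound_def)
  also have "\<dots> = ?r"
  proof -
    have "(4::real) ^ L = 2 ^ L * 2 ^ L" by (simp flip: power_mult_distrib)
    then show ?thesis using assms by simp
  qed
  finally show ?thesis .
qed

lemma interp_cost_le_shell_bound: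
  assumes "1 \<le> nat \<lceil>Lm\<rceil>"
  defines "K \<equiv> nat \<lceil>Lm\<rceil>"
  shows "interp_cost TYPE('n::finite) Mh Lm
           \<le> real Mh * (8 / 3 * 4 ^ K * shell_bound CARD('n) (real K) * shell_bound CARD('n) (real (K - 1)))"
proof -
  let ?B = "\<lambda>L. shell_bound CARD('n) (real L)"
  have nn: "0 \<le> ?B L" for L by (simp add: shell_bound_def)
  have "interp_cost TYPE('n) Mh Lm
      = real Mh * (\<Sum>L = 1..K. real (num_new_points TYPE('n) L) * (2 * real (num_points TYPE('n) (L - 1)) - 1))"
    by (simp add: interp_cost_def K_def sum_distrib_left mult.assoc)
  also have "\<dots> \<le> real Mh * (\<Sum>L = 1..K. 2 * 4 ^ L * (?B K * ?B (K - 1)))"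
  proof (intro mult_left_mono sum_mono)
    fix L assume L: "L \<in> {1..K}"
    have "1 \<le> L" using L by simp
    note level_cost_le[OF this, where 'n = 'n]
    also have "2 * 4 ^ L * ?B L * ?B (L - 1) = 2 * 4 ^ L * (?B L * ?B (L - 1))"
      by (rule mult.assoc)
    also have "\<dots> \<le> 2 * 4 ^ L * (?B K * ?B (K - 1))"
      using L by (intro mult_left_mono mult_mono shell_bound_mono nn) auto
    finally show "real (num_new_points TYPE('n) L) * (2 * real (num_points TYPE('n) (L - 1)) - 1)
        \<le> 2 * 4 ^ L * (?B K * ?B (K - 1))" .
  qed simp
  also have "(\<Sum>L = 1..K. 2 * 4 ^ L * (?B K * ?B (K - 1))) = (\<Sum>L = 1..K. 2 * 4 ^ L) * (?B K * ?B (K - 1))"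
    by (simp add: sum_distrib_right)
  also have "real Mh * \<dots> \<le> real Mh * (8 / 3 * 4 ^ K * (?B K * ?B (K - 1)))"
  proof (intro mult_left_mono mult_right_mono mult_nonneg_nonneg nn)
    have "(\<Sum>L = 1..K. 2 * (4::real) ^ L) = 8 / 3 * (4 ^ K - 1)"
      by (induction K) (auto simp: algebra_simps)
    then show "(\<Sum>L = 1..K. 2 * (4::real) ^ L) \<le> 8 / 3 * 4 ^ K" by simp
  qed simp
  finally show ?thesis by (simp add: mult.assoc)
qed

text \<open>
  Since the last level \<open>K\<close> satisfies \<open>K - 1 \<le> Lm\<close>, rounding costs one step in each of the factors
  that depend on \<open>K\<close>: the constant grows from \<open>8/3\<close> to \<open>(8/3) \<cdot> 4 \<cdot> 3 = 32\<close>.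
\<close>

lemma interp_cost_le:
  assumes Lm: "0 \<le> Lm"
  shows "interp_cost TYPE('n::finite) Mh Lm
           \<le> real Mh * C8 CARD('n) * 4 powr Lm * (1 + Lm / real CARD('n)) ^ (2 * (CARD('n) - 1))"
proof (cases "nat \<lceil>Lm\<rceil> = 0")
  case True
  then show ?thesis
    using Lm by (simp add: interp_cost_def C8_def)
next
  case False
  define K where "K = nat \<lceil>Lm\<rceil>"
  let ?N = "CARD('n)"
  let ?B = "shell_bound ?N"
  have K1: "1 \<le> K" using False unfolding K_def by linarith
  have Km: "real (K - 1) \<le> Lm" using K1 Lm unfolding K_def by linarith
  have N: "1 \<le> ?N" by (simp add: Suc_leI)
  have B1: "?B (real (K - 1)) \<le> ?B Lm" by (intro shell_bound_mono Km) simp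
  have K_eq: "real K = real (K - 1) + 1" using K1 by simp
  have "?B (real K) \<le> 3 * ?B (real (K - 1))"
    unfolding K_eq by (rule shell_bound_add_1_le[OF N]) simp
  with B1 have B2: "?B (real K) \<le> 3 * ?B Lm" by linarith
  have "(4::real) ^ K = 4 powr real K" by (simp add: powr_realpow)
  also have "\<dots> \<le> 4 powr (Lm + 1)" using Km K1 by (intro powr_mono) auto
  finally have P: "(4::real) ^ K \<le> 4 * 4 powr Lm" by (simp add: powr_add)
  have nn: "0 \<le> ?B x" if "0 \<le> x" for x using that by (simp add: shell_bound_def)
  have "interp_cost TYPE('n) Mh Lm \<le> real Mh * (8 / 3 * 4 ^ K * ?B (real K) * ?B (real (K - 1)))"
    unfolding K_def by (rule interp_cost_le_shell_bound[OF K1[unfolded K_def]])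
  also have "\<dots> \<le> real Mh * (8 / 3 * (4 * 4 powr Lm) * (3 * ?B Lm) * ?B Lm)"
    using Lm by (intro mult_mono mult_left_mono P B1 B2 nn mult_nonneg_nonneg order.refl) auto
  also have "\<dots> = real Mh * (32 * 4 powr Lm * (?B Lm)\<^sup>2)"
    by (simp add: power2_eq_square)
  also have "\<dots> \<le> real Mh * (64 * 4 powr Lm * (?B Lm)\<^sup>2)"
    by (intro mult_left_mono mult_right_mono) auto
  also have "(?B Lm)\<^sup>2 = exp (2 * (real ?N - 1)) * (1 + Lm / real ?N) ^ (2 * (?N - 1))"
    by (simp add: shell_bound_def power_mult_distrib power_mult[symmetric] mult.commute
        flip: exp_of_nat_mult)
  finally show ?thesis by (simp add: C8_def mult_ac)
qed

text \<open>
  For \<open>l = ln (3 C_sc / \<epsilon>)\<close> these identities rewrite a bound in terms of the last level as one in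
  terms of the accuracy.
\<close>

lemma
  assumes N: "0 < N" and r: "0 < r" and l: "0 < l"
  defines "\<Lambda> \<equiv> 1 / (r * real N) * l"
  shows four_powr_level: "4 powr (real N / ln 2 * ln \<Lambda>) = \<Lambda> ^ (2 * N)"
    and C2_plus_log: "C2 N r + 1 / ln 2 * ln l = 1 + (real N / ln 2 * ln \<Lambda>) / real N"
proof -
  have pos: "0 < \<Lambda>" using assms by simp
  have "ln (4::real) = 2 * ln 2" using ln_realpow[of 2 2] by simp
  then have "4 powr (real N / ln 2 * ln \<Lambda>) = exp (real (2 * N) * ln \<Lambda>)"
    by (simp add: powr_def)
  also have "\<dots> = \<Lambda> ^ (2 * N)" using pos by (simp only: exp_of_nat_mult exp_ln)
  finally show "4 powr (real N / ln 2 * ln \<Lambda>) = \<Lambda> ^ (2 * N)" .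
  have "ln \<Lambda> = ln (1 / (r * real N)) + ln l"
    unfolding \<Lambda>_def using N r l by (intro ln_mult_pos) auto
  then show "C2 N r + 1 / ln 2 * ln l = 1 + (real N / ln 2 * ln \<Lambda>) / real N"
    using N by (simp add: C2_def field_simps)
qed

theorem theorem4p11:
  fixes D :: "(real ^ 'd::finite) set"
    and \<rho> :: "real ^ 'n::finite \<Rightarrow> real"
    and a f :: "real ^ 'd \<Rightarrow> real ^ 'n \<Rightarrow> real"
    and a_min a_max \<sigma> h0 C_fem C_sc \<delta> r :: real
    and s :: nat
    and u :: "real ^ 'n \<Rightarrow> real ^ 'd \<Rightarrow> real"
    and V :: "real \<Rightarrow> (real ^ 'd \<Rightarrow> real) set"
    and M :: "real \<Rightarrow> nat"
    and u_h :: "real \<Rightarrow> real ^ 'n \<Rightarrow> real ^ 'd \<Rightarrow> real"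
    and \<gamma> :: "'n \<Rightarrow> real"
  assumes dim: "CARD('d) \<in> {1, 2, 3}"
    and domain: "open D" "connected D" "bounded D" "D \<noteq> {}"
    and dens: "density_on_Gam \<rho>"
    and coeff_meas: "\<And>y. y \<in> Gam \<Longrightarrow> (\<lambda>x. a x y) \<in> borel_measurable (lebesgue_on D)"
    and coeff_bounds: "0 < a_min" "\<And>x y. x \<in> D \<Longrightarrow> y \<in> Gam \<Longrightarrow> a_min \<le> a x y \<and> a x y \<le> a_max"
    and source: "\<And>y. y \<in> Gam \<Longrightarrow> (\<lambda>x. f x y) \<in> L2 D"
    and weak_sol: "\<And>y. y \<in> Gam \<Longrightarrow> solves_on D (H01 D) (\<lambda>x. a x y) (\<lambda>x. f x y) (u y)"
    and mesh_range: "0 < h0" "0 < \<sigma>"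
    and fem: "\<And>h. h \<in> {0<..h0} \<Longrightarrow> fe_space D \<sigma> h (V h) (M h)"
    and fem_dim: "(\<lambda>h. real (M h)) \<in> O[at_right 0](\<lambda>h. 1 / h ^ CARD('d))"
    and galerkin: "\<And>h y. h \<in> {0<..h0} \<Longrightarrow> y \<in> Gam \<Longrightarrow>
                     solves_on D (V h) (\<lambda>x. a x y) (\<lambda>x. f x y) (u_h h y)"
    and smooth: "1 \<le> s" "u \<in> L2_param \<rho> (H01 D \<inter> H (s + 1) D) (H_norm (s + 1) D)"
    and C_fem: "0 < C_fem"
      "\<And>h. h \<in> {0<..h0} \<Longrightarrow>
         (\<lambda>y x. u y x - u_h h y x) \<in> L2_param \<rho> (H01 D) (H01_norm D) \<and>
         L2_param_norm \<rho> (H01_norm D) (\<lambda>y x. u y x - u_h h y x) \<le> C_fem * h ^ s"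
    and regularity: "\<And>n. 1 < \<gamma> n" "analytic_extension D \<gamma> u"
      "\<And>h. h \<in> {0<..h0} \<Longrightarrow> analytic_extension D \<gamma> (u_h h)"
    and rate: "0 < \<delta>" "\<delta> < 1" "r = (1 - \<delta>) * (MIN n. ln (\<gamma> n))"
    and C_sc: "0 < C_sc"
      "\<And>w L. w \<in> insert u (u_h ` {0<..h0}) \<Longrightarrow> 1 \<le> L \<Longrightarrow>
         AE y in lebesgue_on Gam.
           H01_norm D (\<lambda>x. w y x - sparse_interp L w y x)
             \<le> C_sc * exp (- r * real CARD('n) * 2 powr (real L / real CARD('n)))"
  shows "\<forall>\<^sub>F \<epsilon> in at_right 0.
     interp_cost TYPE('n) (M (mesh_size C_fem s \<epsilon>)) (L_max CARD('n) r C_sc \<epsilon>)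
       \<le> real (M (mesh_size C_fem s \<epsilon>)) * C8 CARD('n)
          * (1 / (r * real CARD('n)) * ln (3 * C_sc / \<epsilon>)) ^ (2 * CARD('n))
          * (C2 CARD('n) r + 1 / ln 2 * ln (ln (3 * C_sc / \<epsilon>))) ^ (2 * (CARD('n) - 1))"
proof -
  let ?N = "CARD('n)"
  have N: "0 < ?N" by simp
  have "0 < (MIN n. ln (\<gamma> n))"
    using regularity(1) by (subst Min_gr_iff) (auto intro: ln_gt_zero)
  then have r: "0 < r" using rate by simp
  \<comment> \<open>The last level is nonnegative as soon as \<open>ln (3 C_sc / \<epsilon>) \<ge> r N\<close>.\<close>
  have "eventually (\<lambda>\<epsilon>. \<epsilon> < 3 * C_sc / exp (r * real ?N)) (at_right 0)"
    using C_sc(1) by (intro order_tendstoD(2)[OF tendsto_ident_at]) simp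
  moreover have "eventually (\<lambda>\<epsilon>::real. 0 < \<epsilon>) (at_right 0)"
    by (rule eventually_at_right_less)
  ultimately show ?thesis
  proof eventually_elim
    case (elim \<epsilon>)
    let ?l = "ln (3 * C_sc / \<epsilon>)"
    have "exp (r * real ?N) \<le> 3 * C_sc / \<epsilon>"
      using elim by (simp add: field_simps)
    then have l: "r * real ?N \<le> ?l"
      using elim C_sc(1) by (simp add: ln_ge_iff)
    have rN: "0 < r * real ?N" using r N by simp
    have lpos: "0 < ?l" using l rN by linarith
    have "1 \<le> 1 / (r * real ?N) * ?l" using l rN by simp
    then have Lm: "0 \<le> L_max ?N r C_sc \<epsilon>"
      unfolding L_max_def by (intro mult_nonneg_nonneg ln_ge_zero) auto
    show ?case
      using interp_cost_le[OF Lm, where 'n = 'n and Mh = "M (mesh_size C_fem s \<epsilon>)"]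
      unfolding L_max_def four_powr_level[OF N r lpos] C2_plus_log[OF N r lpos] .
  qed
qed

end
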